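(* Let $X$ be a Hilbert space and let $T\in LR(X)$ be Hermitian. Then: (i) $T$ is bounded from below (above) if and only if there exists a constant $C\in\mathbf R$ such that $\langle\tilde T_s(x),[x]\rangle\ge C\|x\|^2$ ($\langle\tilde T_s(x),[x]\rangle\le C\|x\|^2$) for all $x\in D(T)$; (ii) $T$ is non-negative (non-positive) if and only if $\langle\tilde T_s(x),[x]\rangle\ge0$ ($\langle\tilde T_s(x),[x]\rangle\le0$) for all $x\in D(T)$; (iii) $T$ is positive (negative) if and only if $\langle\tilde T_s(x),[x]\rangle>0$ ($\langle\tilde T_s(x),[x]\rangle<0$) for all $x\in D(T)$ with $x\ne0$.
   Context: $LR(X)$ is the set of all linear subspaces of $X\times X$. For $T\in LR(X)$: $D(T)$ is its domain, $T(x)=\{y:(x,y)\in T\}$. $T$ is Hermitian if $\langle y_2,x_1\rangle=\langle x_2,y_1\rangle$ for all $(x_1,y_1),(x_2,y_2)\in T$. Let $T\in LR(X)$ be Hermitian. $T$ is bounded from below (above) if there is $C\in\mathbf R$ with $\langle y,x\rangle\ge C\|x\|^2$ ($\langle y,x\rangle\le C\|x\|^2$) for all $(x,y)\in T$; such a $C$ is called a lower (upper) bound of $T$. $T$ is non-negative (non-positive) if $0$ is a lower (upper) bound of $T$. $T$ is positive (negative) if $\langle y,x\rangle>0$ ($\langle y,x\rangle<0$) for all $(x,y)\in T$ with $x\ne0$. The quotient $X/\overline{T(0)}$, with classes $[x]=x+\overline{T(0)}$, has the inner product $\langle[x],[y]\rangle=\langle x^\perp,y^\perp\rangle$, where $x=x_0+x^\perp$,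 $y=y_0+y^\perp$ with $x_0,y_0\in\overline{T(0)}$ and $x^\perp,y^\perp\in\overline{T(0)}^\perp$. $\tilde T_s$ is the (single-valued) linear operator from $D(T)$ to $X/\overline{T(0)}$ given by $\tilde T_s(x)=[y]$ for any $y\in T(x)$. (For $T$ Hermitian, $\langle\tilde T_s(x),[x]\rangle$ is real for $x\in D(T)$.) *)

theory Defs
  imports "HOL-Analysis.Analysis"
begin

section \<open>Complex Hilbert spaces\<close>

class complex_vector = real_vector +
  fixes scaleC :: "complex \<Rightarrow> 'a \<Rightarrow> 'a" (infixr \<open>*\<^sub>C\<close> 75)
  assumes scaleC_add_right: "a *\<^sub>C (x + y) = a *\<^sub>C x + a *\<^sub>C y"
    and scaleC_add_left: "(a + b) *\<^sub>C x = a *\<^sub>C x + b *\<^sub>C x"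
    and scaleC_scaleC: "a *\<^sub>C b *\<^sub>C x = (a * b) *\<^sub>C x"
    and scaleC_one: "1 *\<^sub>C x = x"
    and scaleR_scaleC: "r *\<^sub>R x = complex_of_real r *\<^sub>C x"

interpretation complex_vector: vector_space "scaleC :: complex \<Rightarrow> 'a \<Rightarrow> 'a::complex_vector"
  by unfold_locales (simp_all add: scaleC_add_right scaleC_add_left scaleC_scaleC scaleC_one)

instantiation prod :: (complex_vector, complex_vector) complex_vector
begin

definition scaleC_prod_def: "c *\<^sub>C p = (c *\<^sub>C fst p, c *\<^sub>C snd p)"

instance
  by standard
    (simp_all add: scaleC_prod_def prod_eq_iff scaleC_add_right scaleC_add_left
      scaleC_scaleC scaleC_one scaleR_scaleC)

end

text \<open>
  The inner product is linear in its first argument. The real inner product, and with it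
  the norm and the topology of the class \<open>real_inner\<close>, is the one induced by \<open>cinner\<close>;
  in particular \<open>cinner x x\<close> is the square of \<open>norm x\<close>.
\<close>

class complex_inner = complex_vector + real_inner +
  fixes cinner :: "'a \<Rightarrow> 'a \<Rightarrow> complex"
  assumes cinner_commute: "cinner x y = cnj (cinner y x)"
    and cinner_add_left: "cinner (x + y) z = cinner x z + cinner y z"
    and cinner_scaleC_left: "cinner (c *\<^sub>C x) y = c * cinner x y"
    and inner_eq_Re_cinner: "inner x y = Re (cinner x y)"

lemma cinner_self: "cinner x x = complex_of_real ((norm x)\<^sup>2)"
proof (rule complex_eqI)
  show "Im (cinner x x) = Im (complex_of_real ((norm x)\<^sup>2))"
    using arg_cong[OF cinner_commute, of Im x x] by simp
qed (simp add: power2_norm_eq_inner inner_eq_Re_cinner)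

class chilbert_space = complex_inner + complete_space

instantiation complex :: chilbert_space
begin

definition scaleC_complex_def: "c *\<^sub>C (z::complex) = c * z"
definition cinner_complex_def: "cinner w (z::complex) = w * cnj z"

instance
  by standard
    (simp_all add: scaleC_complex_def cinner_complex_def algebra_simps scaleR_conv_of_real
      inner_complex_def)

end


section \<open>Linear relations\<close>

definition LR :: "('a::complex_vector \<times> 'a) set set" where
  "LR = {T. complex_vector.subspace T}"

definition hermitian_rel :: "('a::complex_inner \<times> 'a) set \<Rightarrow> bool" where
  "hermitian_rel T \<longleftrightarrow>
    (\<forall>(x1, y1)\<in>T. \<forall>(x2, y2)\<in>T. cinner y2 x1 = cinner x2 y1)"

text \<open>
  Inequalities between complex numbers are those of \<open>HOL-Library.Complex_Order\<close>:
  they compare real parts and require equal imaginary parts. Hence each inequality below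
  also states that the inner product in it is real.
\<close>

definition lower_bound :: "('a::complex_inner \<times> 'a) set \<Rightarrow> real \<Rightarrow> bool" where
  "lower_bound T C \<longleftrightarrow> (\<forall>(x, y)\<in>T. cinner y x \<ge> complex_of_real (C * (norm x)\<^sup>2))"

definition upper_bound :: "('a::complex_inner \<times> 'a) set \<Rightarrow> real \<Rightarrow> bool" where
  "upper_bound T C \<longleftrightarrow> (\<forall>(x, y)\<in>T. cinner y x \<le> complex_of_real (C * (norm x)\<^sup>2))"

definition bounded_from_below :: "('a::complex_inner \<times> 'a) set \<Rightarrow> bool" where
  "bounded_from_below T \<longleftrightarrow> (\<exists>C. lower_bound T C)"

definition bounded_from_above :: "('a::complex_inner \<times> 'a) set \<Rightarrow> bool" where
  "bounded_from_above T \<longleftrightarrow> (\<exists>C. upper_bound T C)"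

definition non_negative_rel :: "('a::complex_inner \<times> 'a) set \<Rightarrow> bool" where
  "non_negative_rel T \<longleftrightarrow> lower_bound T 0"

definition non_positive_rel :: "('a::complex_inner \<times> 'a) set \<Rightarrow> bool" where
  "non_positive_rel T \<longleftrightarrow> upper_bound T 0"

definition positive_rel :: "('a::complex_inner \<times> 'a) set \<Rightarrow> bool" where
  "positive_rel T \<longleftrightarrow> (\<forall>(x, y)\<in>T. x \<noteq> 0 \<longrightarrow> cinner y x > 0)"

definition negative_rel :: "('a::complex_inner \<times> 'a) set \<Rightarrow> bool" where
  "negative_rel T \<longleftrightarrow> (\<forall>(x, y)\<in>T. x \<noteq> 0 \<longrightarrow> cinner y x < 0)"


section \<open>The quotient by a closed subspace\<close>

text \<open>Elements of the quotient of the space by \<open>M\<close> are represented as cosets.\<close>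

definition coset :: "'a::ab_group_add set \<Rightarrow> 'a \<Rightarrow> 'a set" where
  "coset M x = (\<lambda>m. x + m) ` M"

definition ortho_compl :: "'a::complex_inner set \<Rightarrow> 'a set" where
  "ortho_compl M = {x. \<forall>m\<in>M. cinner x m = 0}"

definition perp_part :: "'a::complex_inner set \<Rightarrow> 'a \<Rightarrow> 'a" where
  "perp_part M x = (THE v. v \<in> ortho_compl M \<and> (\<exists>u\<in>M. x = u + v))"

definition quot_cinner :: "'a::complex_inner set \<Rightarrow> 'a set \<Rightarrow> 'a set \<Rightarrow> complex" where
  "quot_cinner M A B =
    (THE c. \<exists>x y. A = coset M x \<and> B = coset M y \<and> c = cinner (perp_part M x) (perp_part M y))"

text \<open>\<open>mul_closure T\<close> is the closure of \<open>T(0)\<close>; \<open>rel_op T\<close> is the operator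
  from the domain of \<open>T\<close> to the quotient by \<open>mul_closure T\<close>.\<close>

definition mul_closure :: "('a::complex_inner \<times> 'a) set \<Rightarrow> 'a set" where
  "mul_closure T = closure (T `` {0})"

definition rel_op :: "('a::complex_inner \<times> 'a) set \<Rightarrow> 'a \<Rightarrow> 'a set" where
  "rel_op T x = (THE A. \<exists>y \<in> T `` {x}. A = coset (mul_closure T) y)"

text \<open>The definite descriptions above are justified by the following facts.\<close>

lemma coset_eq_iff:
  assumes M: "complex_vector.subspace M"
  shows "coset M x = coset M y \<longleftrightarrow> x - y \<in> M"
proof
  assume "coset M x = coset M y"
  moreover have "x \<in> coset M x"
    using complex_vector.subspace_0[OF M] unfolding coset_def by force
  ultimately show "x - y \<in> M"
    by (auto simp: coset_def)
next
  have sub: "coset M x \<subseteq> coset M y" if "x - y \<in> M" for x y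
  proof
    fix z assume "z \<in> coset M x"
    then obtain m where m: "m \<in> M" "z = x + m"
      by (auto simp: coset_def)
    have "z = y + ((x - y) + m)" using m by simp
    with complex_vector.subspace_add[OF M that m(1)] show "z \<in> coset M y"
      unfolding coset_def by blast
  qed
  assume "x - y \<in> M"
  moreover from this have "y - x \<in> M"
    using complex_vector.subspace_neg[OF M, of "x - y"] by simp
  ultimately show "coset M x = coset M y"
    by (simp add: sub subset_antisym)
qed

lemma perp_part_unique:
  assumes M: "complex_vector.subspace M"
    and v: "v \<in> ortho_compl M" and "u \<in> M" and "x = u + v"
  shows "perp_part M x = v"
  unfolding perp_part_def
proof (rule the_equality)
  show "v \<in> ortho_compl M \<and> (\<exists>u\<in>M. x = u + v)" using assms by blast
next
  fix w assume w: "w \<in> ortho_compl M \<and> (\<exists>u\<in>M. x = u + w)"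
  then obtain u' where u': "u' \<in> M" "x = u' + w" by blast
  then have d: "w - v = u - u'" using assms(4) by (simp add: algebra_simps)
  have "u - u' \<in> M" by (rule complex_vector.subspace_diff[OF M \<open>u \<in> M\<close> u'(1)])
  then have "cinner w (u - u') = 0" "cinner v (u - u') = 0"
    using w v by (auto simp: ortho_compl_def)
  moreover have "cinner w (u - u') = cinner (w - v) (u - u') + cinner v (u - u')"
    using cinner_add_left[of "w - v" v "u - u'"] by simp
  ultimately have "cinner (w - v) (w - v) = 0"
    by (simp add: d)
  then show "w = v" by (simp add: cinner_self)
qed

lemma perp_part_cong:
  assumes M: "complex_vector.subspace M" and "coset M x = coset M y"
  shows "perp_part M x = perp_part M y"
proof -
  have iff: "(\<exists>u\<in>M. z = u + v) \<longleftrightarrow> z - v \<in> M" for z v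
    by (auto intro: bexI[of _ "z - v"])
  have d: "x - y \<in> M" using assms coset_eq_iff by blast
  have "x - v \<in> M \<longleftrightarrow> y - v \<in> M" for v
  proof
    assume "x - v \<in> M"
    from complex_vector.subspace_diff[OF M this d] show "y - v \<in> M" by simp
  next
    assume "y - v \<in> M"
    from complex_vector.subspace_add[OF M this d] show "x - v \<in> M" by simp
  qed
  then show ?thesis by (simp add: perp_part_def iff)
qed

lemma quot_cinner_coset:
  assumes "complex_vector.subspace M"
  shows "quot_cinner M (coset M x) (coset M y) = cinner (perp_part M x) (perp_part M y)"
  unfolding quot_cinner_def
proof (rule the_equality)
  show "\<exists>x' y'. coset M x = coset M x' \<and> coset M y = coset M y' \<and>
      cinner (perp_part M x) (perp_part M y) = cinner (perp_part M x') (perp_part M y')"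
    by blast
next
  fix c assume "\<exists>x' y'. coset M x = coset M x' \<and> coset M y = coset M y' \<and>
      c = cinner (perp_part M x') (perp_part M y')"
  then obtain x' y' where *: "coset M x = coset M x'" "coset M y = coset M y'"
      "c = cinner (perp_part M x') (perp_part M y')"
    by blast
  show "c = cinner (perp_part M x) (perp_part M y)"
    unfolding *(3) perp_part_cong[OF assms *(1)] perp_part_cong[OF assms *(2)] ..
qed

lemma rel_op_eq:
  assumes T: "T \<in> LR" and M: "complex_vector.subspace (mul_closure T)" and y: "(x, y) \<in> T"
  shows "rel_op T x = coset (mul_closure T) y"
  unfolding rel_op_def
proof (rule the_equality)
  show "\<exists>y'\<in>T `` {x}. coset (mul_closure T) y = coset (mul_closure T) y'"
    using y by blast
next
  fix A assume "\<exists>y'\<in>T `` {x}. A = coset (mul_closure T) y'"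
  then obtain y' where y': "(x, y') \<in> T" "A = coset (mul_closure T) y'" by blast
  have "complex_vector.subspace T" using T by (simp add: LR_def)
  from complex_vector.subspace_diff[OF this y'(1) y] have "(x, y') - (x, y) \<in> T" .
  then have "y' - y \<in> T `` {0}" by simp
  then have "y' - y \<in> mul_closure T"
    using closure_subset[of "T `` {0}"] unfolding mul_closure_def by blast
  then show "A = coset (mul_closure T) y"
    unfolding y'(2) coset_eq_iff[OF M] .
qed

end

theory Submission
  imports Defs
begin

text \<open>
  Write \<open>M\<close> for the closure of \<open>T(0)\<close>. All six equivalences follow from one identity:
  for every \<open>(x, y) \<in> T\<close>, the inner product of the class \<open>rel_op T x\<close> with the class of \<open>x\<close>
  equals \<open>cinner y x\<close>. Any inequality imposed on \<open>cinner y x\<close> over all pairs of \<open>T\<close> is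
  then the same inequality for the quotient form over the domain of \<open>T\<close>.

  The identity rests on orthogonality. Comparing \<open>(x, y)\<close> with \<open>(0, m) \<in> T\<close>, the Hermitian
  condition gives \<open>cinner m x = cinner 0 y = 0\<close>. So the domain of \<open>T\<close> is orthogonal to
  \<open>T(0)\<close>, and by continuity to \<open>M\<close>. Thus \<open>x\<close> is its own component orthogonal to \<open>M\<close>; and
  if \<open>y = u + v\<close> with \<open>u \<in> M\<close> and \<open>v\<close> orthogonal to \<open>M\<close>, then
  \<open>cinner v x = cinner y x - cinner u x = cinner y x\<close>.

  Completeness of the space enters through the existence of this decomposition of \<open>y\<close>.
  It comes from the point of \<open>M\<close> nearest to \<open>y\<close>, which lies in every set of nearly optimal
  points of \<open>M\<close>; the parallelogram law makes the diameters of these sets tend to zero.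
\<close>

text \<open>
  The midpoint of \<open>a\<close> and \<open>b\<close> is again in \<open>S\<close>, hence at distance at least \<open>infdist y S\<close> from
  \<open>y\<close>; the parallelogram law turns this into a bound on the distance of two nearly optimal points.
\<close>

lemma convex_almost_nearest_dist:
  fixes S :: "'a::real_inner set"
  assumes "convex S" and a: "a \<in> S" "dist y a \<le> r" and b: "b \<in> S" "dist y b \<le> r"
  shows "(dist a b)\<^sup>2 \<le> 4 * (r\<^sup>2 - (infdist y S)\<^sup>2)"
proof -
  let ?m = "(1/2) *\<^sub>R a + (1/2) *\<^sub>R b"
  have "?m \<in> S"
    using convexD[OF assms(1) a(1) b(1), of "1/2" "1/2"] by simp
  then have "(infdist y S)\<^sup>2 \<le> (dist y ?m)\<^sup>2"
    by (intro power_mono infdist_le infdist_nonneg)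
  moreover have "(dist y a)\<^sup>2 \<le> r\<^sup>2" "(dist y b)\<^sup>2 \<le> r\<^sup>2"
    using a(2) b(2) by (auto intro: power_mono)
  moreover have "(dist a b)\<^sup>2 + 4 * (dist y ?m)\<^sup>2 = 2 * (dist y a)\<^sup>2 + 2 * (dist y b)\<^sup>2"
    by (simp add: dist_norm power2_norm_eq_inner inner_simps inner_commute algebra_simps)
  ultimately show ?thesis by simp
qed

lemma closed_convex_nearest_point:
  fixes S :: "'a::{real_inner,complete_space} set"
  assumes "closed S" "convex S" "S \<noteq> {}"
  obtains u where "u \<in> S" "\<And>z. z \<in> S \<Longrightarrow> dist y u \<le> dist y z"
proof -
  define d where "d = infdist y S"
  define r where "r n = d + inverse (real (Suc n))" for n
  have r_lim: "r \<longlonglongrightarrow> d"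
    unfolding r_def using tendsto_add[OF tendsto_const LIMSEQ_inverse_real_of_nat] by simp
  obtain u where u: "\<And>n. u \<in> S \<inter> cball y (r n)"
  proof (rule decreasing_closed_nest[of "\<lambda>n. S \<inter> cball y (r n)"])
    show "closed (S \<inter> cball y (r n))" for n
      using assms(1) by auto
    show "S \<inter> cball y (r n) \<noteq> {}" for n
    proof -
      have "infdist y S < r n" by (simp add: r_def d_def)
      then obtain a where "a \<in> S" "dist y a < r n"
        using \<open>S \<noteq> {}\<close> by (auto simp: infdist_notempty cINF_less_iff)
      then show ?thesis by (auto simp: less_imp_le)
    qed
    show "S \<inter> cball y (r n) \<subseteq> S \<inter> cball y (r m)" if "m \<le> n" for m n
    proof -
      have "r n \<le> r m" using that by (simp add: r_def le_imp_inverse_le)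
      then show ?thesis using subset_cball by blast
    qed
    show "\<exists>n. \<forall>a\<in>S \<inter> cball y (r n). \<forall>b\<in>S \<inter> cball y (r n). dist a b < e" if "e > 0" for e
    proof -
      have "(\<lambda>n. 4 * ((r n)\<^sup>2 - d\<^sup>2)) \<longlonglongrightarrow> 4 * (d\<^sup>2 - d\<^sup>2)"
        by (intro tendsto_intros r_lim)
      then have "eventually (\<lambda>n. 4 * ((r n)\<^sup>2 - d\<^sup>2) < e\<^sup>2) sequentially"
        using \<open>e > 0\<close> by (intro order_tendstoD(2)[of _ "4 * (d\<^sup>2 - d\<^sup>2)"]) auto
      then obtain n where n: "4 * ((r n)\<^sup>2 - d\<^sup>2) < e\<^sup>2"
        by (auto simp: eventually_sequentially)
      have "dist a b < e" if "a \<in> S \<inter> cball y (r n)" "b \<in> S \<inter> cball y (r n)" for a b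
      proof -
        have "(dist a b)\<^sup>2 < e\<^sup>2"
          using convex_almost_nearest_dist[OF assms(2), of a y "r n" b] that n by (auto simp: d_def)
        then show ?thesis using \<open>e > 0\<close> by (auto intro: power2_less_imp_less)
      qed
      then show ?thesis by blast
    qed
  qed blast
  have "dist y u \<le> d"
    using u by (intro LIMSEQ_le_const[OF r_lim]) auto
  then show ?thesis
    using u[of 0] infdist_le[of _ S y] by (intro that[of u]) (auto simp: d_def intro: order_trans)
qed

lemma csubspace_scaleR:
  assumes "complex_vector.subspace M" "x \<in> M"
  shows "r *\<^sub>R x \<in> M"
  using complex_vector.subspace_scale[OF assms] by (simp add: scaleR_scaleC)

lemma csubspace_imp_convex:
  assumes "complex_vector.subspace M"
  shows "convex M"
  by (intro convexI complex_vector.subspace_add[OF assms] csubspace_scaleR[OF assms])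

text \<open>
  Against a complex subspace, real orthogonality is enough: since
  \<open>Im (cinner x m) = inner x (\<i> *\<^sub>C m)\<close>, the imaginary part is tested by the vector \<open>\<i> *\<^sub>C m\<close>.
\<close>

lemma ortho_compl_eq_inner:
  assumes "complex_vector.subspace M"
  shows "ortho_compl M = {x. \<forall>m\<in>M. inner x m = 0}"
proof -
  have Im: "Im (cinner x m) = inner x (\<i> *\<^sub>C m)" for x m
    using cinner_commute[of x m] cinner_commute[of x "\<i> *\<^sub>C m"]
    by (simp add: inner_eq_Re_cinner cinner_scaleC_left)
  show ?thesis
    using complex_vector.subspace_scale[OF assms]
    by (auto simp: ortho_compl_def complex_eq_iff Im inner_eq_Re_cinner[symmetric])
qed

text \<open>
  For the point \<open>u\<close> of \<open>M\<close> nearest to \<open>y\<close>, the vector \<open>y - u\<close> makes no acute angle with any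
  direction \<open>m\<close> in \<open>M\<close>; applied to \<open>m\<close> and \<open>- m\<close> this is orthogonality.
\<close>

lemma orthogonal_decomposition:
  fixes M :: "'a::chilbert_space set"
  assumes M: "complex_vector.subspace M" and "closed M"
  obtains u v where "u \<in> M" "v \<in> ortho_compl M" "y = u + v"
proof -
  note conv = csubspace_imp_convex[OF M]
  have "M \<noteq> {}" using complex_vector.subspace_0[OF M] by blast
  then obtain u where u: "u \<in> M" "\<And>z. z \<in> M \<Longrightarrow> dist y u \<le> dist y z"
    using closed_convex_nearest_point[OF \<open>closed M\<close> conv] by blast
  have le: "inner (y - u) m \<le> 0" if "m \<in> M" for m
    using any_closest_point_dot[OF conv \<open>closed M\<close> u(1), of "u + m" y]
      complex_vector.subspace_add[OF M u(1) that] u(2) by simp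
  have "inner (y - u) m = 0" if "m \<in> M" for m
    using le[OF that] le[OF complex_vector.subspace_neg[OF M that]] by simp
  then have "y - u \<in> ortho_compl M"
    by (simp add: ortho_compl_eq_inner[OF M])
  then show ?thesis using u(1) by (intro that[of u "y - u"]) auto
qed

lemma norm_scaleC:
  fixes x :: "'a::complex_inner"
  shows "norm (c *\<^sub>C x) = cmod c * norm x"
proof -
  have "cinner (c *\<^sub>C x) (c *\<^sub>C x) = c * cnj c * cinner x x"
    using cinner_commute[of x "c *\<^sub>C x"] cinner_commute[of x x] by (simp add: cinner_scaleC_left)
  then have "complex_of_real ((norm (c *\<^sub>C x))\<^sup>2) = complex_of_real ((cmod c * norm x)\<^sup>2)"
    by (simp only: cinner_self complex_norm_square[symmetric] power_mult_distrib of_real_mult)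
  then have "(norm (c *\<^sub>C x))\<^sup>2 = (cmod c * norm x)\<^sup>2"
    by (simp only: of_real_eq_iff)
  then show ?thesis by (simp add: power2_eq_iff_nonneg)
qed

lemma bounded_linear_scaleC:
  "bounded_linear (\<lambda>x::'a::complex_inner. c *\<^sub>C x)"
  by (rule bounded_linear_intro[where K = "cmod c"])
    (simp_all add: scaleC_add_right scaleR_scaleC scaleC_scaleC norm_scaleC mult.commute)

lemma csubspace_closure:
  fixes S :: "'a::complex_inner set"
  assumes S: "complex_vector.subspace S"
  shows "complex_vector.subspace (closure S)"
proof (rule complex_vector.subspaceI)
  show "0 \<in> closure S"
    using complex_vector.subspace_0[OF S] closure_subset by blast
next
  fix x y assume "x \<in> closure S" "y \<in> closure S"
  then obtain f g where "\<forall>n. f n \<in> S" "f \<longlonglongrightarrow> x" "\<forall>n. g n \<in> S" "g \<longlonglongrightarrow> y"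
    by (auto simp: closure_sequential)
  then have "(\<forall>n. f n + g n \<in> S) \<and> (\<lambda>n. f n + g n) \<longlonglongrightarrow> x + y"
    by (simp add: complex_vector.subspace_add[OF S] tendsto_add)
  then show "x + y \<in> closure S"
    unfolding closure_sequential by (rule exI[of _ "\<lambda>n. f n + g n"])
next
  fix c x assume "x \<in> closure S"
  moreover have "scaleC c ` closure S \<subseteq> closure (scaleC c ` S)"
    by (rule closure_bounded_linear_image_subset[OF bounded_linear_scaleC])
  moreover have "scaleC c ` S \<subseteq> S"
    using complex_vector.subspace_scale[OF S] by blast
  ultimately show "c *\<^sub>C x \<in> closure S"
    using closure_mono by blast
qed

lemma csubspace_mul_closure:
  assumes "T \<in> LR"
  shows "complex_vector.subspace (mul_closure T)"
proof -
  have T: "complex_vector.subspace T" using assms by (simp add: LR_def)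
  have "complex_vector.subspace (T `` {0})"
  proof (rule complex_vector.subspaceI)
    show "0 \<in> T `` {0}"
      using complex_vector.subspace_0[OF T] by (simp add: zero_prod_def)
    show "x + y \<in> T `` {0}" if "x \<in> T `` {0}" "y \<in> T `` {0}" for x y
      using complex_vector.subspace_add[OF T, of "(0, x)" "(0, y)"] that by simp
    show "c *\<^sub>C x \<in> T `` {0}" if "x \<in> T `` {0}" for c x
      using complex_vector.subspace_scale[OF T, of "(0, x)" c] that by (simp add: scaleC_prod_def)
  qed
  then show ?thesis unfolding mul_closure_def by (rule csubspace_closure)
qed

lemma hermitian_domain_orthogonal:
  assumes "T \<in> LR" "hermitian_rel T" and xy: "(x, y) \<in> T"
  shows "x \<in> ortho_compl (mul_closure T)"
proof -
  have "inner x m = 0" if "(0, m) \<in> T" for m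
  proof -
    have "cinner m x = cinner 0 y"
      using assms(2) xy that unfolding hermitian_rel_def by blast
    also have "\<dots> = 0"
      using cinner_add_left[of 0 0 y] by simp
    finally show ?thesis
      using inner_eq_Re_cinner[of m x] by (simp add: inner_commute)
  qed
  then have "T `` {0} \<subseteq> {m. inner x m = 0}" by blast
  then have "mul_closure T \<subseteq> {m. inner x m = 0}"
    unfolding mul_closure_def
    by (rule closure_minimal) (intro closed_Collect_eq continuous_intros)
  then show ?thesis
    by (auto simp: ortho_compl_eq_inner[OF csubspace_mul_closure[OF assms(1)]])
qed

text \<open>
  Only the orthogonal component of \<open>y\<close> is seen by the quotient, and \<open>x\<close>, being orthogonal to
  the closure of \<open>T(0)\<close>, does not see the rest of \<open>y\<close> either.
\<close>

lemma quot_cinner_rel_op: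
  fixes T :: "('a::chilbert_space \<times> 'a) set"
  assumes "T \<in> LR" "hermitian_rel T" and xy: "(x, y) \<in> T"
  shows "quot_cinner (mul_closure T) (rel_op T x) (coset (mul_closure T) x) = cinner y x"
proof -
  let ?M = "mul_closure T"
  note M = csubspace_mul_closure[OF assms(1)]
  note x = hermitian_domain_orthogonal[OF assms]
  have px: "perp_part ?M x = x"
    using perp_part_unique[OF M x complex_vector.subspace_0[OF M]] by simp
  have "closed ?M" by (simp add: mul_closure_def)
  then obtain u v where uv: "u \<in> ?M" "v \<in> ortho_compl ?M" "y = u + v"
    using orthogonal_decomposition[OF M] by blast
  have "cinner u x = 0"
    using x uv(1) cinner_commute[of u x] by (simp add: ortho_compl_def)
  then have "cinner y x = cinner v x"
    by (simp add: uv(3) cinner_add_left)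
  moreover have "perp_part ?M y = v"
    by (rule perp_part_unique[OF M uv(2,1,3)])
  ultimately show ?thesis
    by (simp add: rel_op_eq[OF assms(1) M xy] quot_cinner_coset[OF M] px)
qed

theorem theorem3p2:
  fixes T :: "('a::chilbert_space \<times> 'a) set"
  assumes "T \<in> LR" and "hermitian_rel T"
  shows
    "(bounded_from_below T \<longleftrightarrow>
        (\<exists>C::real. \<forall>x\<in>Domain T.
           quot_cinner (mul_closure T) (rel_op T x) (coset (mul_closure T) x) \<ge> complex_of_real (C * (norm x)\<^sup>2)))
     \<and> (bounded_from_above T \<longleftrightarrow>
        (\<exists>C::real. \<forall>x\<in>Domain T.
           quot_cinner (mul_closure T) (rel_op T x) (coset (mul_closure T) x) \<le> complex_of_real (C * (norm x)\<^sup>2)))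
     \<and> (non_negative_rel T \<longleftrightarrow>
        (\<forall>x\<in>Domain T. quot_cinner (mul_closure T) (rel_op T x) (coset (mul_closure T) x) \<ge> 0))
     \<and> (non_positive_rel T \<longleftrightarrow>
        (\<forall>x\<in>Domain T. quot_cinner (mul_closure T) (rel_op T x) (coset (mul_closure T) x) \<le> 0))
     \<and> (positive_rel T \<longleftrightarrow>
        (\<forall>x\<in>Domain T. x \<noteq> 0 \<longrightarrow> quot_cinner (mul_closure T) (rel_op T x) (coset (mul_closure T) x) > 0))
     \<and> (negative_rel T \<longleftrightarrow>
        (\<forall>x\<in>Domain T. x \<noteq> 0 \<longrightarrow> quot_cinner (mul_closure T) (rel_op T x) (coset (mul_closure T) x) < 0))"
proof -
  let ?q = "\<lambda>x. quot_cinner (mul_closure T) (rel_op T x) (coset (mul_closure T) x)"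
  have transfer: "(\<forall>(x, y)\<in>T. P x (cinner y x)) \<longleftrightarrow> (\<forall>x\<in>Domain T. P x (?q x))"
    for P :: "'a \<Rightarrow> complex \<Rightarrow> bool"
  proof -
    have "P x (cinner y x) \<longleftrightarrow> P x (?q x)" if "(x, y) \<in> T" for x y
      using quot_cinner_rel_op[OF assms that] by simp
    then show ?thesis by blast
  qed
  show ?thesis
    unfolding bounded_from_below_def bounded_from_above_def non_negative_rel_def
      non_positive_rel_def positive_rel_def negative_rel_def lower_bound_def upper_bound_def
    by (simp only: mult_zero_left of_real_0 simp_thms
      transfer[of "\<lambda>x c. c \<ge> complex_of_real (C * (norm x)\<^sup>2)" for C]
      transfer[of "\<lambda>x c. c \<le> complex_of_real (C * (norm x)\<^sup>2)" for C]
      transfer[of "\<lambda>x c. c \<ge> 0"] transfer[of "\<lambda>x c. c \<le> 0"]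
      transfer[of "\<lambda>x c. x \<noteq> 0 \<longrightarrow> c > 0"] transfer[of "\<lambda>x c. x \<noteq> 0 \<longrightarrow> c < 0"])
qed

end
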